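(* Let $U$ be a nonempty set, $\varphi$ an MSO formula, and $X,Z$ second-order variables such that $Z$ is substitutable for $X$ in $\varphi$. Then for every interpretation $I$ over $U$, all $D\subseteq U$, $E\subseteq\mathcal P(U)$, $g:V\to U$ with $\mathrm{Range}(g)\subseteq D$ and $G:V_2\to\mathcal P(U)$ with $\mathrm{Range}(G)\subseteq E$, $$\langle I,D,E\rangle,g,G\models^d[X\leftarrow Z](\varphi)\iff\langle I,D,E\rangle,g,G\langle X\leftarrow G(Z)\rangle\models^d\varphi .$$
   Context: **Syntax.** Relation symbols $R=\mathbb N$, first-order variables $V=\mathbb N$ and second-order (monadic) variables $V_2=\mathbb N$ (the two kinds of variables form separate namespaces). MSO formulas: $\varphi,\psi ::= r(x,y)\mid X(x)\mid\neg\varphi\mid\varphi\wedge\psi\mid\exists x.\varphi\mid\exists X.\varphi$ with $r\in R$, $x,y\in V$, $X\in V_2$ (no equality). **Semantics.** $U$ is a fixed nonempty set (the type of individuals). An interpretation $I$ over $U$ assigns to each $r\in R$ a binary relation $I(r)\subseteq U\times U$. Given $I$, $D\subseteq U$, $E\subseteq\mathcal P(U)$, $g:V\to U$, $G:V_2\to\mathcal P(U)$, truth $\langle I,D,E\rangle,g,G\models^d\varphi$ is defined recursively: $r(x,y)$ holds iff $(g(x),g(y))\in I(r)$; $X(x)$ holds iff $g(x)\in G(X)$; $\neg,\wedge$ are classical; $\exists x.\varphi$ holds iff $\langle I,D,E\rangle,g[x\leftarrow d],G\models^d\varphi$ for some $d\in D$; $\exists X.\varphi$ holds iff $\langle I,D,E\rangle,g,G\langle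 X\leftarrow S\rangle\models^d\varphi$ for some $S\in E$. Here $g[x\leftarrow d]$ and $G\langle X\leftarrow S\rangle$ are the usual updates. **Substitution.** $[X\leftarrow Z](\varphi)$ is the result of replacing all free occurrences of the second-order variable $X$ in $\varphi$ by $Z$ (no renaming; first-order binders are transparent, i.e. simply descended through). $Z$ is substitutable for $X$ in $\varphi$ if no free occurrence of $X$ in $\varphi$ lies in the scope of a binder $\exists Z$. *)

theory Defs
  imports Main
begin

type_synonym rel_sym = nat
type_synonym fo_var = nat
type_synonym so_var = nat

datatype mso =
    Rel rel_sym fo_var fo_var
  | Mem so_var fo_var
  | Neg mso
  | Conj mso mso
  | Ex1 fo_var mso
  | Ex2 so_var mso

text \<open>The universe of individuals is the type \<open>'u\<close>; HOL types are nonempty.\<close>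

type_synonym 'u interp = "rel_sym \<Rightarrow> ('u \<times> 'u) set"

primrec satisfies ::
  "'u interp \<Rightarrow> 'u set \<Rightarrow> 'u set set \<Rightarrow> (fo_var \<Rightarrow> 'u) \<Rightarrow> (so_var \<Rightarrow> 'u set) \<Rightarrow> mso \<Rightarrow> bool"
where
  "satisfies I D E g G (Rel r x y) \<longleftrightarrow> (g x, g y) \<in> I r"
| "satisfies I D E g G (Mem X x) \<longleftrightarrow> g x \<in> G X"
| "satisfies I D E g G (Neg \<phi>) \<longleftrightarrow> \<not> satisfies I D E g G \<phi>"
| "satisfies I D E g G (Conj \<phi> \<psi>) \<longleftrightarrow> satisfies I D E g G \<phi> \<and> satisfies I D E g G \<psi>"
| "satisfies I D E g G (Ex1 x \<phi>) \<longleftrightarrow> (\<exists>d\<in>D. satisfies I D E (g(x := d)) G \<phi>)"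
| "satisfies I D E g G (Ex2 X \<phi>) \<longleftrightarrow> (\<exists>S\<in>E. satisfies I D E g (G(X := S)) \<phi>)"

primrec subst2 :: "so_var \<Rightarrow> so_var \<Rightarrow> mso \<Rightarrow> mso" where
  "subst2 X Z (Rel r x y) = Rel r x y"
| "subst2 X Z (Mem Y x) = Mem (if Y = X then Z else Y) x"
| "subst2 X Z (Neg \<phi>) = Neg (subst2 X Z \<phi>)"
| "subst2 X Z (Conj \<phi> \<psi>) = Conj (subst2 X Z \<phi>) (subst2 X Z \<psi>)"
| "subst2 X Z (Ex1 x \<phi>) = Ex1 x (subst2 X Z \<phi>)"
| "subst2 X Z (Ex2 Y \<phi>) = Ex2 Y (if Y = X then \<phi> else subst2 X Z \<phi>)"

text \<open>
  For each free occurrence of \<open>X\<close> in the formula, \<open>free_occ_scopes X\<close> contains the set of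
  all second-order variables \<open>Y\<close> such that the occurrence lies in the scope of a binder
  \<open>\<exists>Y\<close>. It is thus empty iff \<open>X\<close> has no free occurrence.
\<close>

primrec free_occ_scopes :: "so_var \<Rightarrow> mso \<Rightarrow> so_var set set" where
  "free_occ_scopes X (Rel r x y) = {}"
| "free_occ_scopes X (Mem Y x) = (if Y = X then {{}} else {})"
| "free_occ_scopes X (Neg \<phi>) = free_occ_scopes X \<phi>"
| "free_occ_scopes X (Conj \<phi> \<psi>) = free_occ_scopes X \<phi> \<union> free_occ_scopes X \<psi>"
| "free_occ_scopes X (Ex1 x \<phi>) = free_occ_scopes X \<phi>"
| "free_occ_scopes X (Ex2 Y \<phi>) = (if Y = X then {} else insert Y ` free_occ_scopes X \<phi>)"

definition substitutable :: "so_var \<Rightarrow> so_var \<Rightarrow> mso \<Rightarrow> bool" where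
  "substitutable Z X \<phi> \<longleftrightarrow> \<not> (\<exists>B\<in>free_occ_scopes X \<phi>. Z \<in> B)"

end

theory Submission
  imports Defs
begin

text \<open>Induction on the formula: reading \<open>Z\<close> under \<open>G\<close> amounts to
  reading \<open>X\<close> once \<open>X\<close> is given the value \<open>G Z\<close>. Only a
  binder \<open>Ex2 Y\<close> can disturb this. If \<open>Y = X\<close>, it hides \<open>X\<close>
  on both sides; if \<open>Y = Z\<close>, substitutability leaves no free \<open>X\<close> below it,
  so substitution and update are both idle; otherwise it changes neither \<open>X\<close> nor
  \<open>Z\<close>.\<close>

lemma subst2_no_free_occ:
  "free_occ_scopes X \<phi> = {} \<Longrightarrow> subst2 X Z \<phi> = \<phi>"
  by (induction \<phi>) (auto split: if_splits)

lemma satisfies_upd_no_free_occ: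
  "free_occ_scopes X \<phi> = {} \<Longrightarrow>
    satisfies I D E g (G(X := S)) \<phi> \<longleftrightarrow> satisfies I D E g G \<phi>"
proof (induction \<phi> arbitrary: g G)
  case (Ex2 Y \<phi>)
  then show ?case
    by (cases "Y = X") (simp_all add: fun_upd_twist[of X Y]
            del: fun_upd_apply)
qed (auto split: if_splits)

lemma satisfies_subst2:
  "substitutable Z X \<phi> \<Longrightarrow>
    satisfies I D E g G (subst2 X Z \<phi>) \<longleftrightarrow> satisfies I D E g (G(X := G Z)) \<phi>"
\<comment> \<open>Quantifiers update the assignments, so \<open>g\<close> and \<open>G\<close> must
  vary.\<close>
proof (induction \<phi> arbitrary: g G)
  case (Ex2 Y \<phi>)
  show ?case
  proof (cases "Y = X")
    case True
    then show ?thesis by (simp del: fun_upd_apply)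
  next
    case False
    show ?thesis
    proof (cases "Y = Z")
      case True
      \<comment> \<open>A free \<open>X\<close> in the body would have the binder's variable
        \<open>Z\<close> in its scope set.\<close>
      with Ex2.prems False have "free_occ_scopes X \<phi> = {}"
        by (auto simp: substitutable_def)
      then show ?thesis
        using False
        by (simp add: subst2_no_free_occ satisfies_upd_no_free_occ fun_upd_twist[of X Y]
            del: fun_upd_apply)
    next
      case neq: False
      with Ex2.prems False have "substitutable Z X \<phi>"
        by (auto simp: substitutable_def)
      \<comment> \<open>The induction hypothesis is used at \<open>G(Y := S)\<close>, which still
        maps \<open>Z\<close> to \<open>G Z\<close>; the updates at \<open>X\<close> and
        \<open>Y\<close> commute.\<close>
      then show ?thesis
        using Ex2.IH False neq
        by (simp add: fun_upd_twist[of X Y] fun_upd_other del: fun_upd_apply)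
    qed
  qed
qed (auto simp: substitutable_def)

theorem mainTheorem8:
  fixes \<phi> :: mso and X Z :: so_var
    and I :: "'u interp" and D :: "'u set" and E :: "'u set set"
    and g :: "fo_var \<Rightarrow> 'u" and G :: "so_var \<Rightarrow> 'u set"
  assumes "substitutable Z X \<phi>"
    and "range g \<subseteq> D"
    and "range G \<subseteq> E"
  shows "satisfies I D E g G (subst2 X Z \<phi>) \<longleftrightarrow> satisfies I D E g (G(X := G Z)) \<phi>"
  using assms(1) by (rule satisfies_subst2)

end
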